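(* Suppose we are given an order-$d$ $n\times n\times\cdots\times n$ partial tensor $T$ with nonnegative observed entries $a_i$ along the diagonal, i.e. we have $t_{ii\cdots i}=a_i$ for $1\le i\le n$, and all other entries unobserved. Then $T$ is completable if and only if $$\sum_{i=1}^n a_i^{1/d}\le 1.$$
   Context: A partial tensor is a tensor in which only some entries are specified (observed). It is completable if its unobserved entries can be filled in so that the resulting real tensor is a rank-one tensor in the standard simplex, i.e. a tensor of rank one whose entries are nonnegative and sum to one.
   Formalization: The order d and the side length n are both assumed to be at least 2; for d = 1 or n = 1 every entry is observed and the claim fails (e.g. n = 1, d = 2, a_1 = 1/2 is not completable although the sum is at most 1). *)

theory Defs
  imports Complex_Main
begin

text \<open>
  A real tensor of format \<open>ns = [n\<^sub>1, \<dots>, n\<^sub>d]\<close> is a function on multi-indices; the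
  multi-index \<open>(i\<^sub>1, \<dots>, i\<^sub>d)\<close> is the list \<open>[i\<^sub>1, \<dots>, i\<^sub>d]\<close>, with entries counted from 1.
  Values outside \<open>multi_indices ns\<close> carry no meaning and are ignored by every notion below.
\<close>

type_synonym tensor = "nat list \<Rightarrow> real"

text \<open>The value \<open>None\<close> marks an unobserved entry.\<close>

type_synonym partial_tensor = "nat list \<Rightarrow> real option"

definition multi_indices :: "nat list \<Rightarrow> nat list set" where
  "multi_indices ns = {I. length I = length ns \<and> (\<forall>j < length ns. I ! j \<in> {1..ns ! j})}"

lemma finite_multi_indices: "finite (multi_indices ns)"
proof (rule finite_subset)
  show "multi_indices ns \<subseteq> {I. set I \<subseteq> {..Max (set ns)} \<and> length I = length ns}"
  proof
    fix I assume I: "I \<in> multi_indices ns"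
    have "x \<le> Max (set ns)" if "x \<in> set I" for x
    proof -
      from that obtain j where j: "j < length I" "I ! j = x"
        by (auto simp: in_set_conv_nth)
      with I have "x \<le> ns ! j" "ns ! j \<in> set ns"
        by (auto simp: multi_indices_def)
      then show ?thesis
        by (meson List.finite_set Max_ge le_trans)
    qed
    with I show "I \<in> {I. set I \<subseteq> {..Max (set ns)} \<and> length I = length ns}"
      by (auto simp: multi_indices_def)
  qed
  show "finite {I. set I \<subseteq> {..Max (set ns)} \<and> length I = length ns}"
    by (rule finite_lists_length_eq) simp
qed

text \<open>
  Entry \<open>(i\<^sub>1, \<dots>, i\<^sub>d)\<close> of the outer product of the vectors \<open>u 0, \<dots>, u (d - 1)\<close>:
  the vectors are numbered from 0, following list positions, but their coordinates from 1.
\<close>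

definition outer_product :: "(nat \<Rightarrow> nat \<Rightarrow> real) \<Rightarrow> tensor" where
  "outer_product u I = (\<Prod>j < length I. u j (I ! j))"

definition rank_one :: "nat list \<Rightarrow> tensor \<Rightarrow> bool" where
  "rank_one ns S \<longleftrightarrow>
     (\<exists>I \<in> multi_indices ns. S I \<noteq> 0) \<and>
     (\<exists>u. \<forall>I \<in> multi_indices ns. S I = outer_product u I)"

definition in_standard_simplex :: "nat list \<Rightarrow> tensor \<Rightarrow> bool" where
  "in_standard_simplex ns S \<longleftrightarrow>
     (\<forall>I \<in> multi_indices ns. S I \<ge> 0) \<and> (\<Sum>I \<in> multi_indices ns. S I) = 1"

definition completion_of :: "nat list \<Rightarrow> partial_tensor \<Rightarrow> tensor \<Rightarrow> bool" where
  "completion_of ns T S \<longleftrightarrow> (\<forall>I \<in> multi_indices ns. \<forall>x. T I = Some x \<longrightarrow> S I = x)"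

definition completable :: "nat list \<Rightarrow> partial_tensor \<Rightarrow> bool" where
  "completable ns T \<longleftrightarrow>
     (\<exists>S. completion_of ns T S \<and> rank_one ns S \<and> in_standard_simplex ns S)"

end

theory Submission
  imports Defs "HOL-Analysis.Convex"
begin

text \<open>
  Everything rests on one identity: the entries of an outer product of vectors \<open>u\<^sub>j\<close> add up to
  the product of the coordinate sums of the \<open>u\<^sub>j\<close> (\<open>sum_outer_product\<close>). Hence a rank-one tensor
  in the simplex is, up to signs and scaling, an outer product of probability vectors.

  Necessity: when the \<open>u\<^sub>j\<close> are probability vectors, the root \<open>a\<^sub>i\<^sup>1\<^sup>/\<^sup>d\<close> of the diagonal entry
  \<open>a\<^sub>i = \<Prod>\<^sub>j u\<^sub>j(i)\<close> is a geometric mean, so it is at most the arithmetic mean of the \<open>u\<^sub>j(i)\<close>;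
  these arithmetic means sum to 1 over \<open>i\<close> (\<open>sum_geom_mean_le_1\<close>).

  Sufficiency: put \<open>b\<^sub>i = a\<^sub>i\<^sup>1\<^sup>/\<^sup>d\<close>. The vector \<open>b\<close> repeated \<open>d\<close> times has the right diagonal, but the
  entries of its outer product sum to \<open>(\<Sum>\<^sub>i b\<^sub>i)\<^sup>d \<le> 1\<close>, possibly too little. It suffices to
  find two probability vectors \<open>p\<close> and \<open>q\<close> with \<open>p\<^sub>i q\<^sub>i\<^sup>d\<^sup>-\<^sup>1 = b\<^sub>i\<^sup>d\<close> for all \<open>i\<close>, and use \<open>p\<close> once and
  \<open>q\<close> in the other \<open>d - 1\<close> positions. Such a pair comes from the intermediate value theorem
  (\<open>ex_prob_vectors_prod_power\<close>).
\<close>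

lemma multi_indices_Cons:
  "multi_indices (m # ns) = (\<lambda>(i, I). i # I) ` ({1..m} \<times> multi_indices ns)"
proof -
  have "(i # I) \<in> multi_indices (m # ns) \<longleftrightarrow> i \<in> {1..m} \<and> I \<in> multi_indices ns" for i I
    by (auto simp: multi_indices_def less_Suc_eq_0_disj)
  moreover have "I \<noteq> []" if "I \<in> multi_indices (m # ns)" for I
    using that by (auto simp: multi_indices_def)
  ultimately show ?thesis
    by (force simp: image_iff neq_Nil_conv)
qed

lemma replicate_in_multi_indices:
  "i \<in> {1..n} \<Longrightarrow> replicate d i \<in> multi_indices (replicate d n)"
  by (auto simp: multi_indices_def)

lemma outer_product_Cons:
  "outer_product u (i # I) = u 0 i * outer_product (\<lambda>j. u (Suc j)) I"
  by (simp add: outer_product_def prod.lessThan_Suc_shift del: prod.lessThan_Suc)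

lemma sum_outer_product:
  "(\<Sum>I \<in> multi_indices ns. outer_product u I) = (\<Prod>j < length ns. \<Sum>i = 1..ns ! j. u j i)"
proof (induction ns arbitrary: u)
  case Nil
  have "multi_indices [] = {[]}"
    by (auto simp: multi_indices_def)
  then show ?case
    by (simp add: outer_product_def)
next
  case (Cons m ns)
  let ?u' = "\<lambda>j. u (Suc j)"
  have "inj_on (\<lambda>(i, I). i # I) ({1..m} \<times> multi_indices ns)"
    by (auto simp: inj_on_def)
  then have "(\<Sum>I \<in> multi_indices (m # ns). outer_product u I)
      = (\<Sum>(i, I) \<in> {1..m} \<times> multi_indices ns. u 0 i * outer_product ?u' I)"
    by (simp add: multi_indices_Cons sum.reindex case_prod_unfold outer_product_Cons)
  also have "\<dots> = (\<Sum>i = 1..m. u 0 i) * (\<Sum>I \<in> multi_indices ns. outer_product ?u' I)"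
    by (simp add: sum.cartesian_product [symmetric] sum_product)
  finally show ?case
    by (simp add: Cons.IH prod.lessThan_Suc_shift del: prod.lessThan_Suc)
qed

text \<open>
  This is the arithmetic-geometric mean inequality applied to the normalized vectors
  \<open>u\<^sub>j / \<Sum>\<^sub>i u\<^sub>j(i)\<close>: as the normalizing factors have product 1, normalization does not change the
  products over \<open>j\<close>.
\<close>

lemma sum_geom_mean_le_1:
  fixes u :: "'b \<Rightarrow> 'a \<Rightarrow> real"
  assumes "finite J" and "J \<noteq> {}"
    and nonneg: "\<And>j i. j \<in> J \<Longrightarrow> i \<in> A \<Longrightarrow> u j i \<ge> 0"
    and prod_sums: "(\<Prod>j\<in>J. \<Sum>i\<in>A. u j i) = 1"
  shows "(\<Sum>i\<in>A. (\<Prod>j\<in>J. u j i) powr (1 / card J)) \<le> 1"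
proof -
  define s where "s j = (\<Sum>i\<in>A. u j i)" for j
  have s_nz: "s j \<noteq> 0" if "j \<in> J" for j
    using prod_sums that \<open>finite J\<close> by (metis s_def prod_zero_iff zero_neq_one)
  have s_nonneg: "s j \<ge> 0" if "j \<in> J" for j
    unfolding s_def using nonneg that by (intro sum_nonneg) auto
  have "(\<Prod>j\<in>J. u j i) powr (1 / card J) \<le> (\<Sum>j\<in>J. u j i / s j / card J)" if "i \<in> A" for i
  proof -
    have "(\<Prod>j\<in>J. u j i) = (\<Prod>j\<in>J. u j i / s j)"
      using prod_sums by (simp add: prod_dividef s_def)
    then show ?thesis
      using arith_geom_mean[OF \<open>finite J\<close> \<open>J \<noteq> {}\<close>, of "\<lambda>j. u j i / s j"] that nonneg s_nonneg
      by simp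
  qed
  then have "(\<Sum>i\<in>A. (\<Prod>j\<in>J. u j i) powr (1 / card J)) \<le> (\<Sum>i\<in>A. \<Sum>j\<in>J. u j i / s j / card J)"
    by (rule sum_mono)
  also have "\<dots> = (\<Sum>j\<in>J. (\<Sum>i\<in>A. u j i) / s j / card J)"
    by (subst sum.swap) (simp add: sum_divide_distrib)
  also have "\<dots> = 1"
    using s_nz \<open>finite J\<close> \<open>J \<noteq> {}\<close> by (simp add: s_def [symmetric])
  finally show ?thesis .
qed

text \<open>
  Fix distinct indices \<open>k\<close> and \<open>m\<close>. For \<open>t\<close> between 0 and \<open>b\<^sub>k\<close> let \<open>q\<close> have entry \<open>t\<close> at \<open>k\<close> and
  agree with \<open>b\<close> elsewhere, except that the mass missing for a total of 1 is added at \<open>m\<close>. Away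
  from \<open>k\<close> put \<open>p\<^sub>i = b\<^sub>i\<^sup>e\<^sup>+\<^sup>1 / q\<^sub>i\<^sup>e\<close>. There \<open>q\<^sub>i \<ge> b\<^sub>i\<close>, so \<open>q\<^sub>i\<close> vanishes only if \<open>b\<^sub>i\<close> does, in which
  case \<open>x / 0 = 0\<close> makes \<open>p\<^sub>i = 0\<close> as it should be; moreover \<open>p\<^sub>i \<le> b\<^sub>i\<close>. The remaining
  mass \<open>p\<^sub>k = 1 - \<Sum>\<^sub>i\<^sub>\<noteq>\<^sub>k p\<^sub>i\<close> is therefore at least \<open>b\<^sub>k\<close>. So \<open>p\<^sub>k t\<^sup>e\<close>
  is 0 at \<open>t = 0\<close> and at least \<open>b\<^sub>k\<^sup>e\<^sup>+\<^sup>1\<close> at \<open>t = b\<^sub>k\<close>, and some \<open>t\<close> in between solves the equation at \<open>k\<close> too.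
\<close>

lemma ex_prob_vectors_prod_power:
  fixes b :: "'a \<Rightarrow> real"
  assumes "finite A" and "k \<in> A" and "m \<in> A" and "m \<noteq> k" and "e > 0"
    and b_nonneg: "\<And>i. i \<in> A \<Longrightarrow> b i \<ge> 0" and b_sum: "(\<Sum>i\<in>A. b i) \<le> 1"
  shows "\<exists>p q. (\<forall>i\<in>A. p i \<ge> 0 \<and> q i \<ge> 0 \<and> p i * q i ^ e = b i ^ Suc e) \<and>
           (\<Sum>i\<in>A. p i) = 1 \<and> (\<Sum>i\<in>A. q i) = 1"
proof -
  define B where "B = A - {k}"
  define R where "R = (\<Sum>i\<in>B. b i)"
  have split: "(\<Sum>i\<in>A. f i) = f k + (\<Sum>i\<in>B. f i)" for f :: "'a \<Rightarrow> real"
    unfolding B_def using \<open>finite A\<close> \<open>k \<in> A\<close> by (rule sum.remove)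
  have "finite B" "m \<in> B" "k \<notin> B"
    using assms by (auto simp: B_def)
  have R: "b k + R \<le> 1"
    using b_sum by (simp add: split R_def)
  define Q where "Q t i = b i + (if i = m then 1 - R - t else 0)" for t i
  define P where "P t i = b i ^ Suc e / Q t i ^ e" for t i
  define f where "f t = (1 - (\<Sum>i\<in>B. P t i)) * t ^ e" for t
  have bB: "b i \<ge> 0" if "i \<in> B" for i
    using that b_nonneg by (auto simp: B_def)
  have Qb: "Q t i \<ge> b i" if "t \<le> b k" for t i
    using that R by (simp add: Q_def)
  have PQ: "P t i * Q t i ^ e = b i ^ Suc e" if "t \<le> b k" "i \<in> B" for t i
    using Qb[OF that(1), of i] bB[OF that(2)] by (cases "b i = 0") (auto simp: P_def)
  have P_nonneg: "P t i \<ge> 0" if "t \<le> b k" "i \<in> B" for t i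
    using Qb[OF that(1), of i] bB[OF that(2)] by (simp add: P_def)
  have Pb: "P t i \<le> b i" if "t \<le> b k" "i \<in> B" for t i
  proof (cases "b i = 0")
    case False
    have "b i ^ Suc e \<le> b i * Q t i ^ e"
      using Qb[OF that(1), of i] bB[OF that(2)] by (simp add: mult_left_mono power_mono)
    then show ?thesis
      using False Qb[OF that(1), of i] bB[OF that(2)] by (simp add: P_def pos_divide_le_eq)
  qed (simp add: P_def)
  have mass_k: "b k \<le> 1 - (\<Sum>i\<in>B. P t i)" if "t \<le> b k" for t
    using sum_mono[of B "P t" b] Pb[OF that] R by (simp add: R_def)
  have "continuous_on {0..b k} (\<lambda>t. P t i)" if "i \<in> B" for i
  proof (cases "b i = 0")
    \<comment> \<open>The denominator may vanish, but the numerator is 0 throughout.\<close>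
    case True
    then show ?thesis by (simp add: P_def)
  next
    case False
    have "Q t i \<noteq> 0" if "t \<in> {0..b k}" for t
      using Qb[of t i] bB[OF \<open>i \<in> B\<close>] that False by auto
    moreover have "continuous_on {0..b k} (\<lambda>t. Q t i)"
      by (cases "i = m") (auto simp: Q_def intro!: continuous_intros)
    ultimately show ?thesis
      unfolding P_def by (auto intro!: continuous_intros)
  qed
  then have "continuous_on {0..b k} f"
    unfolding f_def by (intro continuous_intros)
  moreover have "f 0 \<le> b k ^ Suc e"
    using \<open>e > 0\<close> b_nonneg[OF \<open>k \<in> A\<close>] by (simp add: f_def zero_power)
  moreover have "b k ^ Suc e \<le> f (b k)"
    using mass_k[of "b k"] b_nonneg[OF \<open>k \<in> A\<close>] by (simp add: f_def mult_right_mono)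
  ultimately obtain t where t: "0 \<le> t" "t \<le> b k" "f t = b k ^ Suc e"
    using IVT'[of f 0 "b k ^ Suc e" "b k"] b_nonneg[OF \<open>k \<in> A\<close>] by auto
  define p where "p i = (if i = k then 1 - (\<Sum>i\<in>B. P t i) else P t i)" for i
  define q where "q i = (if i = k then t else Q t i)" for i
  have pB: "(\<Sum>i\<in>B. p i) = (\<Sum>i\<in>B. P t i)" and qB: "(\<Sum>i\<in>B. q i) = (\<Sum>i\<in>B. Q t i)"
    using \<open>k \<notin> B\<close> by (auto simp: p_def q_def intro!: sum.cong)
  show ?thesis
  proof (intro exI conjI ballI)
    show "p i \<ge> 0" if "i \<in> A" for i
      using that P_nonneg t mass_k[OF t(2)] b_nonneg[OF \<open>k \<in> A\<close>] by (auto simp: p_def B_def)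
    show "q i \<ge> 0" if "i \<in> A" for i
      using t Qb[OF t(2), of i] b_nonneg[OF that] by (auto simp: q_def)
    show "(\<Sum>i\<in>A. p i) = 1"
      by (simp add: split pB) (simp add: p_def)
    have "(\<Sum>i\<in>B. Q t i) = 1 - t"
      using \<open>finite B\<close> \<open>m \<in> B\<close> by (simp add: Q_def sum.distrib R_def)
    then show "(\<Sum>i\<in>A. q i) = 1"
      by (simp add: split qB) (simp add: q_def)
    show "p i * q i ^ e = b i ^ Suc e" if "i \<in> A" for i
      using PQ[OF t(2)] t(3) that by (auto simp: p_def q_def f_def B_def)
  qed
qed

theorem theorem4p1:
  fixes d n :: nat and T :: partial_tensor and a :: "nat \<Rightarrow> real"
  assumes "d \<ge> 2" and "n \<ge> 2"
    and "\<And>i. i \<in> {1..n} \<Longrightarrow> a i \<ge> 0"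
    and "\<And>i. i \<in> {1..n} \<Longrightarrow> T (replicate d i) = Some (a i)"
    and "\<And>I. I \<in> multi_indices (replicate d n) \<Longrightarrow>
           I \<notin> (\<lambda>i. replicate d i) ` {1..n} \<Longrightarrow> T I = None"
  shows "completable (replicate d n) T \<longleftrightarrow> (\<Sum>i = 1..n. a i powr (1 / real d)) \<le> 1"
proof
  let ?M = "multi_indices (replicate d n)"
  assume "completable (replicate d n) T"
  then obtain S u where compl: "completion_of (replicate d n) T S"
    and simplex: "in_standard_simplex (replicate d n) S"
    and u: "\<And>I. I \<in> ?M \<Longrightarrow> S I = outer_product u I"
    unfolding completable_def rank_one_def by blast
  \<comment> \<open>The vectors may have negative coordinates, but the entries of \<open>S\<close> are nonnegative, so
    passing to absolute values does not change \<open>S\<close>.\<close>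
  define v where "v j i = \<bar>u j i\<bar>" for j i
  have v: "S I = outer_product v I" if "I \<in> ?M" for I
  proof -
    have "S I = \<bar>outer_product u I\<bar>"
      using simplex that u[OF that] by (auto simp: in_standard_simplex_def)
    then show ?thesis
      by (simp add: outer_product_def v_def abs_prod)
  qed
  have "(\<Sum>I\<in>?M. outer_product v I) = 1"
    using simplex v by (simp add: in_standard_simplex_def)
  then have "(\<Prod>j<d. \<Sum>i = 1..n. v j i) = 1"
    by (simp add: sum_outer_product)
  then have "(\<Sum>i = 1..n. (\<Prod>j<d. v j i) powr (1 / card {..<d})) \<le> 1"
    using \<open>d \<ge> 2\<close> by (intro sum_geom_mean_le_1) (auto simp: v_def lessThan_empty_iff)
  moreover have "a i = (\<Prod>j<d. v j i)" if "i \<in> {1..n}" for i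
  proof -
    have "S (replicate d i) = a i"
      using compl replicate_in_multi_indices[OF that] assms(4)[OF that]
      unfolding completion_of_def by blast
    then show ?thesis
      using v[OF replicate_in_multi_indices[OF that]] by (simp add: outer_product_def)
  qed
  ultimately show "(\<Sum>i = 1..n. a i powr (1 / real d)) \<le> 1"
    by simp
next
  let ?M = "multi_indices (replicate d n)"
  assume le: "(\<Sum>i = 1..n. a i powr (1 / real d)) \<le> 1"
  obtain e where e: "d = Suc e" "e > 0"
    using \<open>d \<ge> 2\<close> by (cases d) auto
  define b where "b i = a i powr (1 / real d)" for i
  have b_power: "b i ^ d = a i" if "i \<in> {1..n}" for i
    using assms(3)[OF that] \<open>d \<ge> 2\<close>
    by (cases "a i = 0") (auto simp: b_def powr_power)
  have b_le: "(\<Sum>i = 1..n. b i) \<le> 1"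
    using le by (simp add: b_def)
  have b_nonneg: "b i \<ge> 0" for i
    by (simp add: b_def)
  obtain p q
    where pq: "\<forall>i\<in>{1..n}. p i \<ge> 0 \<and> q i \<ge> 0 \<and> p i * q i ^ e = b i ^ Suc e"
      and sums: "(\<Sum>i = 1..n. p i) = 1" "(\<Sum>i = 1..n. q i) = 1"
    using ex_prob_vectors_prod_power[of "{1..n}" 1 2 e b] \<open>n \<ge> 2\<close> \<open>e > 0\<close> b_nonneg b_le
    by auto
  define u where "u j = (if j = 0 then p else q)" for j :: nat
  have "outer_product u (replicate d i) = a i" if "i \<in> {1..n}" for i
  proof -
    have "outer_product u (replicate d i) = p i * q i ^ e"
      by (simp add: e outer_product_Cons) (simp add: outer_product_def u_def)
    then show ?thesis
      using pq that b_power[OF that] e by simp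
  qed
  then have "outer_product u I = x" if "I \<in> ?M" "T I = Some x" for I x
    using assms(4) assms(5)[OF that(1)] that(2) by (cases "I \<in> replicate d ` {1..n}") auto
  then have "completion_of (replicate d n) T (outer_product u)"
    by (simp add: completion_of_def)
  moreover have sum_1: "(\<Sum>I\<in>?M. outer_product u I) = 1"
  proof -
    have "(\<Sum>i = 1..n. u j i) = 1" for j
      using sums by (simp add: u_def)
    then show ?thesis
      by (simp add: sum_outer_product)
  qed
  then have "(\<Sum>I\<in>?M. outer_product u I) \<noteq> 0"
    by simp
  then have "rank_one (replicate d n) (outer_product u)"
    unfolding rank_one_def by (blast elim: sum.not_neutral_contains_not_neutral)
  moreover have "in_standard_simplex (replicate d n) (outer_product u)"
    unfolding in_standard_simplex_def using sum_1 pq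
    by (auto simp: outer_product_def u_def multi_indices_def intro!: prod_nonneg)
  ultimately show "completable (replicate d n) T"
    unfolding completable_def by blast
qed

end
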